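(* Let $\bm F$ be a locally Lipschitz vector field on the $N$-torus that generates a complete flow, let $\Phi_s(\bm\theta_0)$ denote the flow of $\frac{\mathrm d\bm\vartheta}{\mathrm ds}=\bm F(\bm\vartheta)$, $\bm\vartheta(0)=\bm\theta_0$, and let $K:[0,\infty)\to\mathbb R$ be locally integrable (of either sign). Put $S(t)=\int_0^tK(u)\,\mathrm du$. Then for every initial state $\bm\theta_0$ the unique solution of $$\dot{\bm\theta}(t)=K(t)\,\bm F(\bm\theta(t)),\qquad \bm\theta(0)=\bm\theta_0,$$ is $$\bm\theta(t)=\Phi_{S(t)}(\bm\theta_0).$$ In particular, if $K_a,K_b$ are two such protocols with accumulated exposures $S_a(t)=\int_0^tK_a(u)\,\mathrm du$ and $S_b(t)=\int_0^tK_b(u)\,\mathrm du$, if $\bm\theta_a,\bm\theta_b$ are the corresponding solutions with the same initial state, and if $S_a(t_a)=S_b(t_b)$ for some times $t_a,t_b$, then $\bm\theta_a(t_a)=\bm\theta_b(t_b)$.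
   Context: Since $K$ is only locally integrable, a solution means a locally absolutely continuous function satisfying the differential equation for almost every $t$. A vector field on the $N$-torus may be viewed as a vector field on $\mathbb R^N$ that is $2\pi$-periodic in each coordinate. The motivating example is the Kuramoto field $F_i(\bm\theta)=\sum_jA_{ij}\sin(\theta_j-\theta_i)$ with $A$ the symmetric nonnegative adjacency matrix of a fixed connected weighted graph, $A_{ii}=0$. *)

theory Defs
  imports "HOL-Analysis.Analysis"
begin

(* A vector field on the N-torus is given by its lift to R^N, and points of the torus by their
   representatives in R^N; two representatives describe the same point of the torus iff they
   differ by an element of (2 pi Z)^N. *)

definition torus_eq :: "real ^ 'n \<Rightarrow> real ^ 'n \<Rightarrow> bool" where
  "torus_eq x y \<longleftrightarrow> (\<forall>i. \<exists>k::int. x $ i - y $ i = 2 * pi * of_int k)"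

definition torus_vector_field :: "(real ^ 'n \<Rightarrow> real ^ 'n) \<Rightarrow> bool" where
  "torus_vector_field F \<longleftrightarrow> (\<forall>x i. F (x + axis i (2 * pi)) = F x)"

(* The library notion concerns time-dependent families; the family here is constant in time. *)

definition locally_lipschitz :: "(real ^ 'n \<Rightarrow> real ^ 'n) \<Rightarrow> bool" where
  "locally_lipschitz F \<longleftrightarrow> local_lipschitz (UNIV :: real set) UNIV (\<lambda>_. F)"

definition is_complete_flow ::
    "(real ^ 'n \<Rightarrow> real ^ 'n) \<Rightarrow> (real \<Rightarrow> real ^ 'n \<Rightarrow> real ^ 'n) \<Rightarrow> bool" where
  "is_complete_flow F \<Phi> \<longleftrightarrow>
     (\<forall>x. \<Phi> 0 x = x \<and>
          (\<forall>s. ((\<lambda>r. \<Phi> r x) has_vector_derivative F (\<Phi> s x)) (at s)))"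

(* Functions on [0, infinity) are functions on the reals whose values at negative arguments
   are never used. *)

definition locally_integrable :: "(real \<Rightarrow> real) \<Rightarrow> bool" where
  "locally_integrable K \<longleftrightarrow> (\<forall>T\<ge>0. K absolutely_integrable_on {0..T})"

definition exposure :: "(real \<Rightarrow> real) \<Rightarrow> real \<Rightarrow> real" where
  "exposure K t = (LINT u:{0..t}|lebesgue. K u)"

definition absolutely_continuous_on ::
    "real set \<Rightarrow> (real \<Rightarrow> 'a::real_normed_vector) \<Rightarrow> bool" where
  "absolutely_continuous_on I f \<longleftrightarrow>
     (\<forall>\<epsilon>>0. \<exists>\<delta>>0. \<forall>(n::nat) a b.
        (\<forall>i<n. a i \<le> b i \<and> {a i..b i} \<subseteq> I) \<and>
        disjoint_family_on (\<lambda>i. {a i<..<b i}) {..<n} \<and>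
        (\<Sum>i<n. b i - a i) < \<delta> \<longrightarrow>
        (\<Sum>i<n. norm (f (b i) - f (a i))) < \<epsilon>)"

(* Solutions in the sense of Caratheodory on [0, infinity). *)

definition protocol_solution ::
    "(real ^ 'n \<Rightarrow> real ^ 'n) \<Rightarrow> (real \<Rightarrow> real) \<Rightarrow> real ^ 'n \<Rightarrow> (real \<Rightarrow> real ^ 'n) \<Rightarrow> bool" where
  "protocol_solution F K x \<theta> \<longleftrightarrow>
     (\<forall>T\<ge>0. absolutely_continuous_on {0..T} \<theta>) \<and>
     \<theta> 0 = x \<and>
     (AE t in lebesgue. t \<ge> 0 \<longrightarrow>
        (\<theta> has_vector_derivative K t *\<^sub>R F (\<theta> t)) (at t within {0..}))"

end

(* The exposure S is absolutely continuous with
   S' = K almost everywhere (Lebesgue differentiation), and s \<mapsto> \<Phi> s x is C^1, hence Lipschitz on the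
   compact range of S, so the chain rule applies. For uniqueness, a Caratheodory solution satisfies the integral
   equation, and two solutions with equal initial state agree on every interval so short that
   L * \<integral>\<bar>K\<bar> < 1/2, where L is a Lipschitz constant of F on the compact union of both trajectories; the
   length of these intervals is uniform on [0, T]. For representatives y, x of the same point of
   the torus, periodicity makes \<theta> + (x - y) a solution starting at x. *)

theory Submission
  imports Defs
begin

section \<open>Absolutely continuous functions\<close>

text \<open>As \<open>K\<close> is merely locally integrable, trajectories are differentiable only
  off a null set, and an almost everywhere derivative does not determine a function: the Cantor
  function is not constant, yet its derivative is zero almost everywhere. Absolute continuity
  excludes this. Most of the work lies in two facts of real analysis: an absolutely continuous
  function is the integral of its almost everywhere derivative, and an indefinite integral has its
  integrand as derivative almost everywhere. Both are argued with tagged divisions of the gauge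
  integral, so integrability of the right-hand side along a solution comes out as a conclusion. In
  the existence part the exceptional set is that of \<open>exposure K\<close> alone, because the
  flow is differentiable at every parameter. The sign of \<open>K\<close> matters only for the range
  of \<open>exposure K\<close>, which may run back and forth into negative values; a complete flow
  is defined there. In the uniqueness part the maximal distance over a short interval takes the
  place of a Gronwall estimate.\<close>

lemma absolutely_continuous_onD_family:
  assumes "absolutely_continuous_on I f" "e > 0"
  obtains d where "d > 0"
    "\<And>(D :: 'i set) a b. \<lbrakk>finite D; \<And>i. i \<in> D \<Longrightarrow> a i \<le> b i \<and> {a i..b i} \<subseteq> I;
       disjoint_family_on (\<lambda>i. {a i<..<b i}) D; (\<Sum>i\<in>D. b i - a i) < d\<rbrakk>
       \<Longrightarrow> (\<Sum>i\<in>D. norm (f (b i) - f (a i))) < e"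
proof -
  obtain d where "d > 0" and d: "\<And>(n::nat) a b. \<lbrakk>\<forall>i<n. a i \<le> b i \<and> {a i..b i} \<subseteq> I;
       disjoint_family_on (\<lambda>i. {a i<..<b i}) {..<n}; (\<Sum>i<n. b i - a i) < d\<rbrakk>
       \<Longrightarrow> (\<Sum>i<n. norm (f (b i) - f (a i))) < e"
    using assms unfolding absolutely_continuous_on_def by meson
  show ?thesis
  proof (rule that[OF \<open>d > 0\<close>])
    fix D :: "'i set" and a b :: "'i \<Rightarrow> real"
    assume D: "finite D" "\<And>i. i \<in> D \<Longrightarrow> a i \<le> b i \<and> {a i..b i} \<subseteq> I"
       "disjoint_family_on (\<lambda>i. {a i<..<b i}) D" "(\<Sum>i\<in>D. b i - a i) < d"
    \<comment> \<open>The definition speaks of families numbered by an initial segment of the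
      naturals, whereas the families used below are sets of tagged intervals or a single interval.
      Numbering \<open>D\<close> bridges the two.\<close>
    obtain h where h: "bij_betw h {..<card D} D"
      using ex_bij_betw_nat_finite[OF \<open>finite D\<close>] by (auto simp: atLeast0LessThan)
    have inD: "h i \<in> D" if "i < card D" for i
      using bij_betwE[OF h] that by auto
    have "(\<Sum>i<card D. norm (f (b (h i)) - f (a (h i)))) < e"
    proof (rule d)
      show "\<forall>i<card D. a (h i) \<le> b (h i) \<and> {a (h i)..b (h i)} \<subseteq> I"
        using D(2) inD by blast
      show "disjoint_family_on (\<lambda>i. {a (h i)<..<b (h i)}) {..<card D}"
        unfolding disjoint_family_on_def
      proof (intro ballI impI)
        fix i j assume "i \<in> {..<card D}" "j \<in> {..<card D}" "i \<noteq> j"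
        then have "h i \<in> D" "h j \<in> D" "h i \<noteq> h j"
          using inD bij_betw_imp_inj_on[OF h] by (auto simp: inj_on_def)
        then show "{a (h i)<..<b (h i)} \<inter> {a (h j)<..<b (h j)} = {}"
          using D(3) unfolding disjoint_family_on_def by blast
      qed
      show "(\<Sum>i<card D. b (h i) - a (h i)) < d"
        using D(4) sum.reindex_bij_betw[OF h, of "\<lambda>i. b i - a i"] by simp
    qed
    then show "(\<Sum>i\<in>D. norm (f (b i) - f (a i))) < e"
      using sum.reindex_bij_betw[OF h, of "\<lambda>i. norm (f (b i) - f (a i))"] by simp
  qed
qed

lemma absolutely_continuous_on_subset:
  "absolutely_continuous_on I f \<Longrightarrow> J \<subseteq> I \<Longrightarrow> absolutely_continuous_on J f"
  unfolding absolutely_continuous_on_def by (meson order_trans)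

lemma absolutely_continuous_on_add_const:
  "absolutely_continuous_on I f \<Longrightarrow> absolutely_continuous_on I (\<lambda>t. f t + c)"
  unfolding absolutely_continuous_on_def by simp

lemma absolutely_continuous_on_transform:
  assumes f: "absolutely_continuous_on I f" and eq: "\<And>x. x \<in> I \<Longrightarrow> g x = f x"
  shows "absolutely_continuous_on I g"
proof -
  have "(\<Sum>i<n. norm (g (b i) - g (a i))) = (\<Sum>i<n. norm (f (b i) - f (a i)))"
    if ab: "\<forall>i<n. a i \<le> b i \<and> {a i..b i} \<subseteq> I" for n :: nat and a b
  proof (rule sum.cong[OF refl])
    fix i assume "i \<in> {..<n}"
    then have "a i \<le> b i" "{a i..b i} \<subseteq> I" using ab by auto
    then show "norm (g (b i) - g (a i)) = norm (f (b i) - f (a i))"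
      by (simp add: eq subset_iff)
  qed
  then show ?thesis
    using f unfolding absolutely_continuous_on_def by (simp cong: conj_cong)
qed

text \<open>A family with one member, indexed by \<open>unit\<close>. That \<open>d\<close> does not
  depend on the position of the interval gives continuity here and a uniform step length in the
  uniqueness proof.\<close>

lemma absolutely_continuous_on_small_interval:
  assumes "absolutely_continuous_on I f" "e > 0"
  obtains d where "d > 0"
    "\<And>u v. \<lbrakk>u \<le> v; {u..v} \<subseteq> I; v - u < d\<rbrakk> \<Longrightarrow> norm (f v - f u) < e"
proof (rule absolutely_continuous_onD_family[OF assms])
  fix d :: real
  assume d: "d > 0" "\<And>(D :: unit set) a b. \<lbrakk>finite D; \<And>i. i \<in> D \<Longrightarrow> a i \<le> b i \<and> {a i..b i} \<subseteq> I;
       disjoint_family_on (\<lambda>i. {a i<..<b i}) D; (\<Sum>i\<in>D. b i - a i) < d\<rbrakk>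
       \<Longrightarrow> (\<Sum>i\<in>D. norm (f (b i) - f (a i))) < e"
  show ?thesis
  proof (rule that[OF d(1)])
    fix u v assume "u \<le> v" "{u..v} \<subseteq> I" "v - u < d"
    then show "norm (f v - f u) < e"
      using d(2)[of "{()}" "\<lambda>_. u" "\<lambda>_. v"] by (simp add: disjoint_family_on_def)
  qed
qed

lemma absolutely_continuous_on_imp_continuous_on:
  assumes "absolutely_continuous_on {a..b} f"
  shows "continuous_on {a..b} f"
  unfolding continuous_on_iff
proof (intro ballI allI impI)
  fix x e :: real assume x: "x \<in> {a..b}" and "e > 0"
  then obtain d where "d > 0" and
    d: "\<And>u v. \<lbrakk>u \<le> v; {u..v} \<subseteq> {a..b}; v - u < d\<rbrakk> \<Longrightarrow> norm (f v - f u) < e"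
    using absolutely_continuous_on_small_interval[OF assms] by metis
  have "dist (f y) (f x) < e" if "y \<in> {a..b}" "dist y x < d" for y
    using d[of x y] d[of y x] that x
    by (cases "x \<le> y") (auto simp: dist_norm norm_minus_commute)
  then show "\<exists>d>0. \<forall>x'\<in>{a..b}. dist x' x < d \<longrightarrow> dist (f x') (f x) < e"
    using \<open>d > 0\<close> by blast
qed

lemma absolutely_continuous_on_lipschitz_compose:
  assumes f: "absolutely_continuous_on I f" and g: "B-lipschitz_on X g" and X: "f ` I \<subseteq> X"
  shows "absolutely_continuous_on I (\<lambda>t. g (f t))"
  unfolding absolutely_continuous_on_def
proof (intro allI impI)
  fix e :: real assume "e > 0"
  have B: "B \<ge> 0" using g by (rule lipschitz_on_nonneg)
  \<comment> \<open>The denominator is \<open>B + 1\<close> because the Lipschitz constant may be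
    zero.\<close>
  then have e: "e / (B + 1) > 0" using \<open>e > 0\<close> by simp
  obtain d where "d > 0" and d: "\<And>(n::nat) a b. \<lbrakk>\<forall>i<n. a i \<le> b i \<and> {a i..b i} \<subseteq> I;
       disjoint_family_on (\<lambda>i. {a i<..<b i}) {..<n}; (\<Sum>i<n. b i - a i) < d\<rbrakk>
       \<Longrightarrow> (\<Sum>i<n. norm (f (b i) - f (a i))) < e / (B + 1)"
    using f e unfolding absolutely_continuous_on_def by meson
  have "(\<Sum>i<n. norm (g (f (b i)) - g (f (a i)))) < e"
    if n: "\<forall>i<n. a i \<le> b i \<and> {a i..b i} \<subseteq> I"
       "disjoint_family_on (\<lambda>i. {a i<..<b i}) {..<n}" "(\<Sum>i<n. b i - a i) < d" for n :: nat and a b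
  proof -
    have "(\<Sum>i<n. norm (g (f (b i)) - g (f (a i)))) \<le> (\<Sum>i<n. B * norm (f (b i) - f (a i)))"
    proof (rule sum_mono)
      fix i assume "i \<in> {..<n}"
      then have "a i \<le> b i" "{a i..b i} \<subseteq> I" using n(1) by auto
      then have "a i \<in> I" "b i \<in> I" by auto
      then show "norm (g (f (b i)) - g (f (a i))) \<le> B * norm (f (b i) - f (a i))"
        using X by (intro lipschitz_on_normD[OF g]) auto
    qed
    also have "\<dots> \<le> (B + 1) * (\<Sum>i<n. norm (f (b i) - f (a i)))"
      unfolding sum_distrib_left[symmetric]
      by (intro mult_right_mono sum_nonneg) auto
    also have "\<dots> < e"
      using d[OF n] B by (simp add: field_simps)
    finally show ?thesis .
  qed
  then show "\<exists>d>0. \<forall>(n::nat) a b. (\<forall>i<n. a i \<le> b i \<and> {a i..b i} \<subseteq> I) \<and>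
        disjoint_family_on (\<lambda>i. {a i<..<b i}) {..<n} \<and> (\<Sum>i<n. b i - a i) < d \<longrightarrow>
        (\<Sum>i<n. norm (g (f (b i)) - g (f (a i)))) < e"
    using \<open>d > 0\<close> by blast
qed

text \<open>The increment \<open>f b - f a\<close> telescopes over any tagged division and is
  compared with the Riemann sum piece by piece. Pieces tagged outside \<open>N\<close> are handled
  by the derivative at the tag, pieces tagged in \<open>N\<close> by absolute continuity; each group
  may cost \<open>e / 2\<close>.\<close>

theorem fundamental_theorem_of_calculus_absolutely_continuous:
  fixes f :: "real \<Rightarrow> 'a::banach"
  assumes "a \<le> b" and f: "absolutely_continuous_on {a..b} f" and N: "negligible N"
    and vecd: "\<And>x. x \<in> {a..b} - N \<Longrightarrow> (f has_vector_derivative f' x) (at x within {a..b})"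
  shows "(f' has_integral (f b - f a)) {a..b}"
proof -
  \<comment> \<open>Nothing is known about \<open>f'\<close> on \<open>N\<close>. Setting it to zero
    there leaves only the increments of \<open>f\<close> on the pieces tagged in \<open>N\<close>;
    the null set is put back at the end.\<close>
  define g where "g x = (if x \<in> N then 0 else f' x)" for x
  have "(g has_integral (f b - f a)) {a..b}"
    unfolding has_integral_real
  proof (intro allI impI)
    fix e :: real assume "e > 0"
    \<comment> \<open>The error allowed per unit length, so that all pieces together cost at most
      \<open>e / 2\<close>. The summand 1 covers the case \<open>a = b\<close>.\<close>
    define c where "c = e / (2 * (b - a + 1))"
    have "c > 0" using \<open>e > 0\<close> \<open>a \<le> b\<close> by (simp add: c_def)
    have cab: "c * (b - a) \<le> e / 2"
      using \<open>e > 0\<close> \<open>a \<le> b\<close> by (simp add: c_def field_simps)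
    have "\<forall>x. \<exists>d>0. x \<in> {a..b} - N \<longrightarrow>
         (\<forall>y\<in>{a..b}. norm (y-x) < d \<longrightarrow> norm (f y - f x - (y-x) *\<^sub>R f' x) \<le> c * norm (y-x))"
      using vecd[unfolded has_vector_derivative_def has_derivative_within_alt] \<open>c > 0\<close>
      by (metis zero_less_one)
    then obtain d where d: "\<And>x. 0 < d x"
                 "\<And>x y. \<lbrakk>x \<in> {a..b} - N; y \<in> {a..b}; norm (y-x) < d x\<rbrakk>
                        \<Longrightarrow> norm (f y - f x - (y-x) *\<^sub>R f' x) \<le> c * norm (y-x)"
      by metis
    obtain \<delta> where "\<delta> > 0" and \<delta>: "\<And>(D :: (real \<times> real set) set) u v. \<lbrakk>finite D;
       \<And>i. i \<in> D \<Longrightarrow> u i \<le> v i \<and> {u i..v i} \<subseteq> {a..b};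
       disjoint_family_on (\<lambda>i. {u i<..<v i}) D; (\<Sum>i\<in>D. v i - u i) < \<delta>\<rbrakk>
       \<Longrightarrow> (\<Sum>i\<in>D. norm (f (v i) - f (u i))) < e / 2"
      by (rule absolutely_continuous_onD_family[OF f half_gt_zero[OF \<open>e > 0\<close>]]) blast
    txt \<open>A gauge for the indicator of \<open>N\<close> forces the pieces tagged in \<open>N\<close> to have total length below
      \<open>\<delta>\<close>, so that absolute continuity controls their contribution.\<close>
    have "(indicat_real N has_integral 0) {a..b}"
      using N unfolding negligible_def by (metis box_real(2))
    then obtain \<gamma> where "gauge \<gamma>" and \<gamma>: "\<And>p. \<lbrakk>p tagged_division_of {a..b}; \<gamma> fine p\<rbrakk> \<Longrightarrow>
        norm ((\<Sum>(x,k)\<in>p. measure lborel k *\<^sub>R indicat_real N x) - 0) < \<delta>"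
      unfolding has_integral_real using \<open>\<delta> > 0\<close> by meson
    show "\<exists>\<gamma>. gauge \<gamma> \<and> (\<forall>p. p tagged_division_of {a..b} \<and> \<gamma> fine p \<longrightarrow>
        norm ((\<Sum>(x,k)\<in>p. measure lborel k *\<^sub>R g x) - (f b - f a)) < e)"
    proof (intro exI conjI allI impI)
      show "gauge (\<lambda>x. \<gamma> x \<inter> ball x (d x))"
        using \<open>gauge \<gamma>\<close> d(1) by (intro gauge_Int gauge_ball_dependent) auto
      fix p assume "p tagged_division_of {a..b} \<and> (\<lambda>x. \<gamma> x \<inter> ball x (d x)) fine p"
      then have p: "p tagged_division_of {a..b}" and "\<gamma> fine p" and finep: "(\<lambda>x. ball x (d x)) fine p"
        by (auto simp: fine_Int)
      have "finite p" using p by blast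
      have K: "\<exists>u v. K = {u..v} \<and> u \<le> v \<and> x \<in> {u..v} \<and> {u..v} \<subseteq> {a..b}" if "(x, K) \<in> p" for x K
        using tagged_division_ofD(2-4)[OF p that] by (metis atLeastAtMost_iff box_real(2) order_trans)
      have ba: "b - a = (\<Sum>(x,K)\<in>p. Sup K - Inf K)" "f b - f a = (\<Sum>(x,K)\<in>p. f(Sup K) - f(Inf K))"
        using additive_tagged_division_1[where f= "\<lambda>x. x"] additive_tagged_division_1[where f= f]
              \<open>a \<le> b\<close> p by auto
      define D where "D = {i \<in> p. fst i \<in> N}"
      have "finite D" "D \<subseteq> p" using \<open>finite p\<close> by (auto simp: D_def)
      have "(\<Sum>i\<in>D. norm (f (Sup (snd i)) - f (Inf (snd i)))) < e / 2"
      proof (rule \<delta>[OF \<open>finite D\<close>])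
        fix i assume "i \<in> D"
        then show "Inf (snd i) \<le> Sup (snd i) \<and> {Inf (snd i)..Sup (snd i)} \<subseteq> {a..b}"
          using K[of "fst i" "snd i"] by (auto simp: D_def)
      next
        show "disjoint_family_on (\<lambda>i. {Inf (snd i)<..<Sup (snd i)}) D"
          unfolding disjoint_family_on_def
        proof (intro ballI impI)
          fix i j assume ij: "i \<in> D" "j \<in> D" "i \<noteq> j"
          then have "interior (snd i) \<inter> interior (snd j) = {}"
            using tagged_division_ofD(5)[OF p, of "fst i" "snd i" "fst j" "snd j"]
            by (auto simp: D_def prod_eq_iff)
          moreover obtain u v u' v' where "snd i = {u..v}" "u \<le> v" "snd j = {u'..v'}" "u' \<le> v'"
            using K[of "fst i" "snd i"] K[of "fst j" "snd j"] ij by (auto simp: D_def)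
          ultimately show "{Inf (snd i)<..<Sup (snd i)} \<inter> {Inf (snd j)<..<Sup (snd j)} = {}"
            by simp
        qed
      next
        have "(\<Sum>i\<in>D. Sup (snd i) - Inf (snd i)) = (\<Sum>(x,k)\<in>D. measure lborel k *\<^sub>R indicat_real N x)"
        proof (rule sum.cong[OF refl], clarify)
          fix x k assume "(x, k) \<in> D"
          then show "Sup (snd (x,k)) - Inf (snd (x,k)) = measure lborel k *\<^sub>R indicat_real N x"
            using K[of x k] by (auto simp: D_def)
        qed
        also have "\<dots> = (\<Sum>(x,k)\<in>p. measure lborel k *\<^sub>R indicat_real N x)"
          by (rule sum.mono_neutral_left) (auto simp: D_def indicator_eq_0_iff \<open>finite p\<close>)
        also have "\<dots> < \<delta>"
          using \<gamma>[OF p \<open>\<gamma> fine p\<close>] by simp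
        finally show "(\<Sum>i\<in>D. Sup (snd i) - Inf (snd i)) < \<delta>" .
      qed
      moreover have "(\<Sum>i\<in>p - D. norm (measure lborel (snd i) *\<^sub>R f' (fst i) - (f (Sup (snd i)) - f (Inf (snd i)))))
          \<le> (\<Sum>i\<in>p - D. c * (Sup (snd i) - Inf (snd i)))"
      proof (rule sum_mono)
        fix i assume "i \<in> p - D"
        obtain x k where i: "i = (x, k)" by (cases i)
        with \<open>i \<in> p - D\<close> have xk: "(x, k) \<in> p" and xN: "x \<notin> N" by (auto simp: D_def)
        then obtain u v where k: "k = {u..v}" and uv: "u \<le> v" "x \<in> {u..v}" "{u..v} \<subseteq> {a..b}"
          using K by blast
        have ball: "y \<in> ball x (d x)" if "y \<in> k" for y
          using finep xk that by blast
        have x: "x \<in> {a..b} - N" using uv xN by auto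
        \<comment> \<open>Straddle estimate: both endpoints are compared with the tag
          \<open>x\<close>, and since \<open>x\<close> lies between them the two distances add up to
          exactly \<open>v - u\<close>.\<close>
        have "norm ((v - u) *\<^sub>R f' x - (f v - f u))
            = norm (f u - f x - (u - x) *\<^sub>R f' x - (f v - f x - (v - x) *\<^sub>R f' x))"
          by (auto simp: algebra_simps)
        also have "\<dots> \<le> norm (f u - f x - (u - x) *\<^sub>R f' x) + norm (f v - f x - (v - x) *\<^sub>R f' x)"
          by (rule norm_triangle_ineq4)
        also have "\<dots> \<le> c * norm (u - x) + c * norm (v - x)"
          using ball[of u] ball[of v] uv k
          by (intro add_mono d(2)[OF x]) (auto simp: dist_norm norm_minus_commute)
        also have "\<dots> = c * (v - u)"
          using uv by (simp add: algebra_simps)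
        finally show "norm (measure lborel (snd i) *\<^sub>R f' (fst i) - (f (Sup (snd i)) - f (Inf (snd i))))
            \<le> c * (Sup (snd i) - Inf (snd i))"
          using uv by (simp add: i k)
      qed
      moreover have "(\<Sum>i\<in>p - D. c * (Sup (snd i) - Inf (snd i))) \<le> e / 2"
      proof -
        have "(\<Sum>i\<in>p - D. c * (Sup (snd i) - Inf (snd i))) \<le> (\<Sum>i\<in>p. c * (Sup (snd i) - Inf (snd i)))"
        proof (rule sum_mono2)
          fix i assume "i \<in> p - (p - D)"
          then show "0 \<le> c * (Sup (snd i) - Inf (snd i))"
            using K[of "fst i" "snd i"] \<open>c > 0\<close> by auto
        qed (use \<open>finite p\<close> in auto)
        also have "\<dots> = c * (b - a)"
          unfolding ba(1) sum_distrib_left by (simp add: case_prod_beta)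
        finally show ?thesis using cab by linarith
      qed
      moreover have "norm ((\<Sum>(x,k)\<in>p. measure lborel k *\<^sub>R g x) - (f b - f a))
         \<le> (\<Sum>i\<in>p - D. norm (measure lborel (snd i) *\<^sub>R f' (fst i) - (f (Sup (snd i)) - f (Inf (snd i)))))
           + (\<Sum>i\<in>D. norm (f (Sup (snd i)) - f (Inf (snd i))))"
      proof -
        have "(\<Sum>(x,k)\<in>p. measure lborel k *\<^sub>R g x) - (f b - f a)
            = (\<Sum>i\<in>p. measure lborel (snd i) *\<^sub>R g (fst i) - (f (Sup (snd i)) - f (Inf (snd i))))"
          unfolding ba(2) by (simp add: case_prod_beta sum_subtractf)
        also have "norm \<dots> \<le> (\<Sum>i\<in>p. norm (measure lborel (snd i) *\<^sub>R g (fst i) - (f (Sup (snd i)) - f (Inf (snd i)))))"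
          by (rule norm_sum)
        also have "\<dots> = (\<Sum>i\<in>p - D. norm (measure lborel (snd i) *\<^sub>R g (fst i) - (f (Sup (snd i)) - f (Inf (snd i)))))
           + (\<Sum>i\<in>D. norm (measure lborel (snd i) *\<^sub>R g (fst i) - (f (Sup (snd i)) - f (Inf (snd i)))))"
          by (rule sum.subset_diff[OF \<open>D \<subseteq> p\<close> \<open>finite p\<close>])
        also have "\<dots> = (\<Sum>i\<in>p - D. norm (measure lborel (snd i) *\<^sub>R f' (fst i) - (f (Sup (snd i)) - f (Inf (snd i)))))
           + (\<Sum>i\<in>D. norm (f (Sup (snd i)) - f (Inf (snd i))))"
          by (intro arg_cong2[where f="(+)"] sum.cong) (auto simp: g_def D_def norm_minus_commute)
        finally show ?thesis .
      qed
      ultimately show "norm ((\<Sum>(x,k)\<in>p. measure lborel k *\<^sub>R g x) - (f b - f a)) < e"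
        by linarith
    qed
  qed
  then show ?thesis
    by (rule has_integral_spike[OF N, rotated]) (simp add: g_def)
qed

section \<open>Indefinite integrals\<close>

text \<open>Closed intervals of the family may share endpoints, so the integral is taken over the
  union of the open ones, which has the same value. Nonnegativity then permits enlarging the domain
  to \<open>{a..b}\<close>.\<close>

lemma sum_integral_disjoint_intervals_le:
  fixes g :: "real \<Rightarrow> real"
  assumes g: "g integrable_on {a..b}" and nonneg: "\<And>x. x \<in> {a..b} \<Longrightarrow> 0 \<le> g x"
    and D: "finite D" "\<And>i. i \<in> D \<Longrightarrow> {u i..v i} \<subseteq> {a..b}"
      "disjoint_family_on (\<lambda>i. {u i<..<v i}) D"
  shows "(\<Sum>i\<in>D. integral {u i..v i} g) \<le> integral {a..b} g"
proof -
  have sub: "{u i<..<v i} \<subseteq> {a..b}" if "i \<in> D" for i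
    using D(2)[OF that] greaterThanLessThan_subseteq_atLeastAtMost_iff by fastforce
  have int: "g integrable_on {u i..v i}" if "i \<in> D" for i
    using g D(2)[OF that] by (rule integrable_on_subinterval)
  have "(g has_integral (\<Sum>i\<in>D. integral {u i..v i} g)) (\<Union>i\<in>D. {u i<..<v i})"
  proof (rule has_integral_UN[OF D(1)])
    fix i assume "i \<in> D"
    then show "(g has_integral integral {u i..v i} g) {u i<..<v i}"
      using int by (metis box_real has_integral_open_interval integrable_integral)
  qed (use D(3) in \<open>auto simp: pairwise_def disjoint_family_on_def\<close>)
  with UN_least[OF sub] show ?thesis
    by (rule has_integral_subset_le[OF _ _ integrable_integral[OF g]]) (simp_all add: nonneg)
qed

lemma absolutely_continuous_on_integral:
  fixes f :: "real \<Rightarrow> 'a::euclidean_space"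
  assumes f: "f absolutely_integrable_on {a..b}"
  shows "absolutely_continuous_on {a..b} (\<lambda>t. integral {a..t} f)"
  unfolding absolutely_continuous_on_def
proof (intro allI impI)
  fix e :: real assume "e > 0"
  txt \<open>Truncation: \<open>f\<close> splits into a part bounded by \<open>n\<close> and a part of integral below \<open>e / 2\<close>.\<close>
  define h where "h n x = min (norm (f x)) (real n)" for n x
  have fint: "f integrable_on {a..b}" and nf: "(\<lambda>x. norm (f x)) integrable_on {a..b}"
    using f by (auto simp: absolutely_integrable_on_def)
  have nfa: "(\<lambda>x. norm (f x)) absolutely_integrable_on {a..b}"
    using absolutely_integrable_norm[OF f] by (simp add: o_def)
  have hint: "h n integrable_on {a..b}" for n
    unfolding h_def
    by (intro set_lebesgue_integral_eq_integral absolutely_integrable_min_1 nfa)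
       (auto simp: absolutely_integrable_on_def intro: integrable_continuous_real)
  have "(\<lambda>n. integral {a..b} (h n)) \<longlonglongrightarrow> integral {a..b} (\<lambda>x. norm (f x))"
  proof (rule dominated_convergence(2)[OF hint nf])
    fix x
    show "(\<lambda>n. h n x) \<longlonglongrightarrow> norm (f x)"
    proof (rule tendsto_eventually)
      obtain m :: nat where "norm (f x) \<le> real m" using real_arch_simple by blast
      then show "\<forall>\<^sub>F n in sequentially. h n x = norm (f x)"
        unfolding eventually_sequentially h_def by (intro exI[of _ m]) auto
    qed
  qed (simp add: h_def)
  then have "\<forall>\<^sub>F n in sequentially. integral {a..b} (\<lambda>x. norm (f x)) - e / 2 < integral {a..b} (h n)"
    by (rule order_tendstoD) (use \<open>e > 0\<close> in simp)
  then obtain n where n: "integral {a..b} (\<lambda>x. norm (f x)) - e / 2 < integral {a..b} (h n)"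
    using eventually_sequentially by auto
  define g where "g x = norm (f x) - h n x" for x
  have gint: "g integrable_on {a..b}"
    unfolding g_def using nf hint by (rule integrable_diff)
  have gi: "integral {a..b} g < e / 2"
    using n unfolding g_def by (simp add: integral_diff nf hint)
  \<comment> \<open>Chosen so that the part bounded by \<open>n\<close> contributes less than
    \<open>e / 2\<close> on intervals of total length below \<open>d\<close>; the summand 1 covers
    \<open>n = 0\<close>. The remainder \<open>g\<close> is bounded by its integral over all of
    \<open>{a..b}\<close>, whatever the intervals.\<close>
  define d where "d = e / (2 * (real n + 1))"
  have "d > 0" using \<open>e > 0\<close> by (simp add: d_def)
  have nd: "real n * d < e / 2" using \<open>e > 0\<close> by (simp add: d_def field_simps)
  have "(\<Sum>i<k. norm (integral {a..v i} f - integral {a..u i} f)) < e"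
    if uv: "\<forall>i<k. u i \<le> v i \<and> {u i..v i} \<subseteq> {a..b}"
      and disj: "disjoint_family_on (\<lambda>i. {u i<..<v i}) {..<k}"
      and len: "(\<Sum>i<k. v i - u i) < d" for k :: nat and u v
  proof -
    have "norm (integral {a..v i} f - integral {a..u i} f) \<le> integral {u i..v i} g + real n * (v i - u i)"
      if "i < k" for i
    proof -
      have i: "u i \<le> v i" "{u i..v i} \<subseteq> {a..b}" using uv that by auto
      then have i': "a \<le> u i" "v i \<le> b" by auto
      have "integral {a..u i} f + integral {u i..v i} f = integral {a..v i} f"
        using i i' by (intro Henstock_Kurzweil_Integration.integral_combine integrable_on_subinterval[OF fint]) auto
      then have "norm (integral {a..v i} f - integral {a..u i} f) = norm (integral {u i..v i} f)"
        by (simp add: algebra_simps flip: eq_diff_eq)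
      \<comment> \<open>Pointwise \<open>norm (f x) = g x + h n x\<close>, and the truncation
        \<open>h n\<close> is at most \<open>n\<close>.\<close>
      also have "\<dots> \<le> integral {u i..v i} (\<lambda>x. g x + real n)"
      proof (rule integral_norm_bound_integral)
        show "f integrable_on {u i..v i}" "(\<lambda>x. g x + real n) integrable_on {u i..v i}"
          using fint gint i by (auto intro!: integrable_add intro: integrable_on_subinterval)
      qed (auto simp: g_def h_def)
      also have "\<dots> = integral {u i..v i} g + real n * (v i - u i)"
        using integrable_on_subinterval[OF gint i(2)] i by (subst integral_add) auto
      finally show ?thesis .
    qed
    then have "(\<Sum>i<k. norm (integral {a..v i} f - integral {a..u i} f))
       \<le> (\<Sum>i<k. integral {u i..v i} g + real n * (v i - u i))"
      by (intro sum_mono) auto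
    also have "\<dots> = (\<Sum>i<k. integral {u i..v i} g) + real n * (\<Sum>i<k. v i - u i)"
      by (simp add: sum.distrib sum_distrib_left)
    also have "\<dots> \<le> integral {a..b} g + real n * d"
    proof (rule add_mono)
      show "(\<Sum>i<k. integral {u i..v i} g) \<le> integral {a..b} g"
        using uv disj by (intro sum_integral_disjoint_intervals_le gint) (auto simp: g_def h_def)
      show "real n * (\<Sum>i<k. v i - u i) \<le> real n * d"
        using len by (intro mult_left_mono) auto
    qed
    also have "\<dots> < e" using gi nd by linarith
    finally show ?thesis .
  qed
  then show "\<exists>\<delta>>0. \<forall>(k::nat) u v. (\<forall>i<k. u i \<le> v i \<and> {u i..v i} \<subseteq> {a..b}) \<and>
        disjoint_family_on (\<lambda>i. {u i<..<v i}) {..<k} \<and> (\<Sum>i<k. v i - u i) < \<delta> \<longrightarrow>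
        (\<Sum>i<k. norm (integral {a..v i} f - integral {a..u i} f)) < e"
    using \<open>d > 0\<close> by blast
qed

section \<open>Lebesgue differentiation of indefinite integrals\<close>

text \<open>The set consists of the points where the difference quotients miss \<open>f x\<close> by
  more than \<open>\<eta>\<close> at arbitrarily small scales. A difference quotient at
  \<open>x\<close> belongs to an interval with \<open>x\<close> as an endpoint, on either side; such
  an \<open>x\<close> is also an admissible tag of that interval.\<close>

lemma negligible_indefinite_integral_not_differentiable:
  fixes f :: "real \<Rightarrow> 'a::euclidean_space"
  assumes f: "f integrable_on {a..b}" and "\<eta> > 0"
  shows "negligible {x \<in> {a..b}. \<forall>d>0. \<exists>u v. a \<le> u \<and> u < v \<and> v \<le> b \<and> (x = u \<or> x = v) \<and> v - u < d \<and>
             \<eta> * (v - u) < norm ((v - u) *\<^sub>R f x - integral {u..v} f)}" (is "negligible ?B")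
  unfolding negligible_outer_le
proof (intro allI impI)
  fix e :: real assume "e > 0"
  \<comment> \<open>A bad interval has an error above \<open>\<eta>\<close> times its length, so a
    total error below \<open>\<eta> * e\<close> forces a total length below
    \<open>e\<close>.\<close>
  then have "\<eta> * e > 0" using \<open>\<eta> > 0\<close> by simp
  with f obtain \<gamma> where "gauge \<gamma>" and \<gamma>: "\<And>p. \<lbrakk>p tagged_partial_division_of cbox a b; \<gamma> fine p\<rbrakk> \<Longrightarrow>
       (\<Sum>(x,k)\<in>p. norm (measure lborel k *\<^sub>R f x - integral k f)) < \<eta> * e"
    using Henstock_lemma[of f a b "\<eta> * e"] unfolding box_real(2) by blast
  txt \<open>By Henstock's lemma disjoint \<open>\<gamma>\<close>-fine bad intervals have total length below \<open>e\<close>, and by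
    Vitali's theorem countably many of them cover the bad points up to a null set.\<close>
  define K where "K = {(x, u, v). a \<le> u \<and> u < v \<and> v \<le> b \<and> (x = u \<or> x = v) \<and> {u..v} \<subseteq> \<gamma> x \<and>
             \<eta> * (v - u) < norm ((v - u) *\<^sub>R f x - integral {u..v} f)}"
  \<comment> \<open>The covering theorem is formulated for closed balls: \<open>m\<close> and
    \<open>r\<close> are centre and radius of the interval \<open>I i\<close>. The tag is an
    endpoint of the interval and differs from the centre, hence the triples.\<close>
  define I :: "real \<times> real \<times> real \<Rightarrow> real set" where "I i = {fst (snd i)..snd (snd i)}" for i
  define m :: "real \<times> real \<times> real \<Rightarrow> real" where "m i = (fst (snd i) + snd (snd i)) / 2" for i
  define r :: "real \<times> real \<times> real \<Rightarrow> real" where "r i = (snd (snd i) - fst (snd i)) / 2" for i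
  have cball: "cball (m i) (r i) = I i" for i
    unfolding I_def m_def r_def cball_eq_atLeastAtMost by (simp add: field_simps)
  obtain C where C: "countable C" "C \<subseteq> K"
     and disj: "pairwise (\<lambda>i j. disjnt (cball (m i) (r i)) (cball (m j) (r j))) C"
     and neg: "negligible (?B - (\<Union>i \<in> C. cball (m i) (r i)))"
  proof (rule Vitali_covering_theorem_cballs[of K r ?B m])
    fix i assume "i \<in> K"
    then show "0 < r i" by (auto simp: K_def r_def)
  next
    fix x d :: real assume x: "x \<in> ?B" and "0 < d"
    obtain c where "c > 0" and c: "ball x c \<subseteq> \<gamma> x"
      using \<open>gauge \<gamma>\<close> by (meson gaugeD openE)
    have "min c d > 0" using \<open>c > 0\<close> \<open>d > 0\<close> by simp
    then obtain u v where uv: "a \<le> u" "u < v" "v \<le> b" "x = u \<or> x = v" "v - u < min c d"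
             "\<eta> * (v - u) < norm ((v - u) *\<^sub>R f x - integral {u..v} f)"
      using x by blast
    have "{u..v} \<subseteq> ball x c" using uv by (auto simp: dist_real_def)
    then have "(x, u, v) \<in> K" using uv c by (auto simp: K_def)
    moreover have "x \<in> cball (m (x,u,v)) (r (x,u,v))" "r (x,u,v) < d"
      unfolding cball using uv by (auto simp: I_def r_def)
    ultimately show "\<exists>i. i \<in> K \<and> x \<in> cball (m i) (r i) \<and> r i < d"
      by blast
  qed
  \<comment> \<open>Henstock's lemma concerns finite partial divisions only. The bound
    \<open>e\<close> is the same for every finite subfamily and therefore passes to the countable
    union.\<close>
  have bound: "measure lebesgue (\<Union>i\<in>C'. I i) \<le> e" if "C' \<subseteq> C" "finite C'" for C'
  proof -
    define p where "p = (\<lambda>i. (fst i, I i)) ` C'"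
    have C'K: "i \<in> K" if "i \<in> C'" for i using that \<open>C' \<subseteq> C\<close> C(2) by blast
    \<comment> \<open>Nondegenerate intervals determine their endpoints, so no two triples collapse
      to one tagged interval and the sum over \<open>p\<close> is a sum over
      \<open>C'\<close>.\<close>
    have inj: "inj_on (\<lambda>i. (fst i, I i)) C'"
    proof (rule inj_onI)
      fix i j assume "i \<in> C'" "j \<in> C'" and eq: "(fst i, I i) = (fst j, I j)"
      then have "fst (snd i) < snd (snd i)" "fst (snd j) < snd (snd j)"
        using C'K[of i] C'K[of j] by (auto simp: K_def)
      then show "i = j" using eq by (auto simp: I_def prod_eq_iff Icc_eq_Icc)
    qed
    have "p tagged_partial_division_of cbox a b"
      unfolding tagged_partial_division_of_def
    proof (intro conjI allI impI)
      show "finite p" using that by (simp add: p_def)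
    next
      fix x k assume "(x, k) \<in> p"
      then obtain u v where "(x,u,v) \<in> C'" "k = {u..v}" by (auto simp: p_def I_def)
      then show "x \<in> k" "k \<subseteq> cbox a b" "\<exists>a b. k = cbox a b"
        using C'K[of "(x,u,v)"] by (auto simp: K_def)
    next
      fix x k x' k' assume *: "(x, k) \<in> p \<and> (x', k') \<in> p \<and> (x, k) \<noteq> (x', k')"
      then obtain i j where "i \<in> C'" "j \<in> C'" "i \<noteq> j" "k = I i" "k' = I j"
        unfolding p_def by fast
      then have "disjnt k k'" using disj \<open>C' \<subseteq> C\<close> unfolding pairwise_def cball by blast
      then show "interior k \<inter> interior k' = {}"
        by (auto simp: disjnt_def dest: subsetD[OF interior_subset])
    qed
    moreover have "\<gamma> fine p"
    proof (rule fineI)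
      fix x k assume "(x, k) \<in> p"
      then obtain u v where "(x,u,v) \<in> C'" "k = {u..v}" by (auto simp: p_def I_def)
      then show "k \<subseteq> \<gamma> x" using C'K[of "(x,u,v)"] by (auto simp: K_def)
    qed
    ultimately have "(\<Sum>(x,k)\<in>p. norm (measure lborel k *\<^sub>R f x - integral k f)) < \<eta> * e"
      by (rule \<gamma>)
    then have sum: "(\<Sum>i\<in>C'. norm (measure lborel (I i) *\<^sub>R f (fst i) - integral (I i) f)) < \<eta> * e"
      unfolding p_def by (simp add: sum.reindex[OF inj])
    have "measure lebesgue (\<Union>i\<in>C'. I i) \<le> (\<Sum>i\<in>C'. measure lebesgue (I i))"
      by (rule measure_UNION_le[OF \<open>finite C'\<close>]) (simp add: I_def)
    then have "\<eta> * measure lebesgue (\<Union>i\<in>C'. I i) \<le> (\<Sum>i\<in>C'. \<eta> * measure lebesgue (I i))"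
      using \<open>\<eta> > 0\<close> by (simp add: sum_distrib_left[symmetric])
    also have "\<dots> \<le> (\<Sum>i\<in>C'. norm (measure lborel (I i) *\<^sub>R f (fst i) - integral (I i) f))"
    proof (rule sum_mono)
      fix i assume "i \<in> C'"
      then show "\<eta> * measure lebesgue (I i) \<le> norm (measure lborel (I i) *\<^sub>R f (fst i) - integral (I i) f)"
        using C'K[of i] by (auto simp: K_def I_def)
    qed
    also have "\<dots> < \<eta> * e" by (rule sum)
    finally show ?thesis using \<open>\<eta> > 0\<close> by simp
  qed
  have U: "(\<Union>i\<in>C. I i) \<in> lmeasurable" "measure lebesgue (\<Union>i\<in>C. I i) \<le> e"
    using fmeasurable_UN_bound[OF C(1), of I lebesgue e] measure_UN_bound[OF C(1), of I lebesgue e] bound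
    by (auto simp: I_def)
  let ?T = "(\<Union>i\<in>C. I i) \<union> (?B - (\<Union>i\<in>C. I i))"
  have neg': "negligible (?B - (\<Union>i\<in>C. I i))" using neg by (simp add: cball)
  have "?T \<in> lmeasurable"
    by (intro fmeasurable.Un U(1) negligible_imp_measurable neg')
  moreover have "measure lebesgue ?T \<le> e"
    using measure_Un_le[of "\<Union>i\<in>C. I i" lebesgue "?B - (\<Union>i\<in>C. I i)"] U
      negligible_imp_measurable[OF neg'] negligible_imp_measure0[OF neg'] by (auto dest: fmeasurableD)
  ultimately show "\<exists>T. ?B \<subseteq> T \<and> T \<in> lmeasurable \<and> measure lebesgue T \<le> e"
    by (intro exI[of _ ?T]) blast
qed

text \<open>The tolerances \<open>1 / real (Suc n)\<close> suffice, since some of them lies below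
  any given \<open>e\<close>; countably many null sets have a null union.\<close>

theorem lebesgue_differentiation_indefinite_integral:
  fixes f :: "real \<Rightarrow> 'a::euclidean_space"
  assumes f: "f integrable_on {a..b}"
  obtains N where "negligible N"
    "\<And>x. x \<in> {a..b} - N \<Longrightarrow>
       ((\<lambda>t. integral {a..t} f) has_vector_derivative f x) (at x within {a..b})"
proof -
  define B where "B \<eta> = {x \<in> {a..b}. \<forall>d>0. \<exists>u v. a \<le> u \<and> u < v \<and> v \<le> b \<and> (x = u \<or> x = v) \<and> v - u < d \<and>
             \<eta> * (v - u) < norm ((v - u) *\<^sub>R f x - integral {u..v} f)}" for \<eta> :: real
  show ?thesis
  proof
    show "negligible (\<Union>n. B (1 / real (Suc n)))"
      unfolding B_def
      by (intro negligible_Union_nat negligible_indefinite_integral_not_differentiable f) simp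
    fix x assume x: "x \<in> {a..b} - (\<Union>n. B (1 / real (Suc n)))"
    show "((\<lambda>t. integral {a..t} f) has_vector_derivative f x) (at x within {a..b})"
      unfolding has_vector_derivative_def has_derivative_within_alt
    proof (intro conjI allI impI bounded_linear_scaleR_left)
      fix e :: real assume "e > 0"
      then obtain n where n: "1 / real (Suc n) < e" using nat_approx_posE by blast
      have "x \<in> {a..b}" "x \<notin> B (1 / real (Suc n))" using x by auto
      then have "\<not> (\<forall>d>0. \<exists>u v. a \<le> u \<and> u < v \<and> v \<le> b \<and> (x = u \<or> x = v) \<and> v - u < d \<and>
          1 / real (Suc n) * (v - u) < norm ((v - u) *\<^sub>R f x - integral {u..v} f))"
        by (simp only: B_def mem_Collect_eq simp_thms not_False_eq_True)
      then obtain d where "d > 0" and nd: "\<not> (\<exists>u v. a \<le> u \<and> u < v \<and> v \<le> b \<and> (x = u \<or> x = v) \<and> v - u < d \<and>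
          1 / real (Suc n) * (v - u) < norm ((v - u) *\<^sub>R f x - integral {u..v} f))"
        by blast
      have d: "\<lbrakk>a \<le> u; u < v; v \<le> b; x = u \<or> x = v; v - u < d\<rbrakk> \<Longrightarrow>
          norm ((v - u) *\<^sub>R f x - integral {u..v} f) \<le> 1 / real (Suc n) * (v - u)" for u v
        using nd linorder_not_less by blast
      have d': "norm (integral {a..v} f - integral {a..u} f - (v - u) *\<^sub>R f x) \<le> e * (v - u)"
        if uv: "a \<le> u" "u < v" "v \<le> b" "x = u \<or> x = v" "v - u < d" for u v
      proof -
        have "integral {a..u} f + integral {u..v} f = integral {a..v} f"
          using uv by (intro Henstock_Kurzweil_Integration.integral_combine integrable_on_subinterval[OF f]) auto
        then have "norm (integral {a..v} f - integral {a..u} f - (v - u) *\<^sub>R f x)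
           = norm ((v - u) *\<^sub>R f x - integral {u..v} f)"
          by (metis add_diff_cancel_left' norm_minus_commute)
        also have "\<dots> \<le> 1 / real (Suc n) * (v - u)" by (rule d[OF uv])
        also have "\<dots> \<le> e * (v - u)" using n uv by (intro mult_right_mono) auto
        finally show ?thesis .
      qed
      have "norm (integral {a..y} f - integral {a..x} f - (y - x) *\<^sub>R f x) \<le> e * norm (y - x)"
        if y: "y \<in> {a..b}" "norm (y - x) < d" for y
      proof (cases x y rule: linorder_cases)
        case less
        then show ?thesis using d'[of x y] y x by auto
      next
        case greater
        have "norm (integral {a..y} f - integral {a..x} f - (y - x) *\<^sub>R f x)
            = norm (integral {a..x} f - integral {a..y} f - (x - y) *\<^sub>R f x)"
          by (subst norm_minus_cancel[symmetric]) (simp add: algebra_simps)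
        then show ?thesis using d'[of y x] y x greater by auto
      qed simp
      then show "\<exists>d>0. \<forall>y\<in>{a..b}. norm (y - x) < d \<longrightarrow>
          norm (integral {a..y} f - integral {a..x} f - (y - x) *\<^sub>R f x) \<le> e * norm (y - x)"
        using \<open>d > 0\<close> by blast
    qed
  qed
qed

section \<open>Protocols\<close>

lemma exposure_eq_integral:
  assumes "locally_integrable K" "t \<ge> 0"
  shows "exposure K t = integral {0..t} K"
  using assms unfolding exposure_def locally_integrable_def
  by (intro set_lebesgue_integral_eq_integral) auto

lemma absolutely_continuous_on_exposure:
  assumes K: "locally_integrable K" and "T \<ge> 0"
  shows "absolutely_continuous_on {0..T} (exposure K)"
proof -
  have "absolutely_continuous_on {0..T} (\<lambda>t. integral {0..t} K)"
    using assms by (intro absolutely_continuous_on_integral) (auto simp: locally_integrable_def)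
  then show ?thesis
    by (rule absolutely_continuous_on_transform) (simp add: exposure_eq_integral[OF K])
qed

text \<open>The differentiation theorem lives on compact intervals, so the exceptional sets of all
  \<open>{0..real n}\<close> are collected into one null set.\<close>

lemma AE_exposure_has_vector_derivative:
  assumes K: "locally_integrable K"
  shows "AE t in lebesgue. t \<ge> 0 \<longrightarrow> (exposure K has_vector_derivative K t) (at t within {0..})"
proof -
  have "\<exists>N. negligible N \<and> (\<forall>t\<in>{0..real n} - N.
       ((\<lambda>t. integral {0..t} K) has_vector_derivative K t) (at t within {0..real n}))" for n
  proof -
    have "K integrable_on {0..real n}"
      using K unfolding locally_integrable_def by (intro set_lebesgue_integral_eq_integral) auto
    from lebesgue_differentiation_indefinite_integral[OF this] show ?thesis by metis
  qed
  then obtain N where N: "\<And>n. negligible (N n)" "\<And>n t. t \<in> {0..real n} - N n \<Longrightarrow>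
       ((\<lambda>t. integral {0..t} K) has_vector_derivative K t) (at t within {0..real n})"
    by metis
  have "negligible (\<Union>n. N n)" using N(1) by (rule negligible_Union_nat)
  then have "AE t in lebesgue. t \<notin> (\<Union>n. N n)"
    by (simp only: negligible_iff_null_sets AE_not_in)
  then show ?thesis
  proof eventually_elim
    case (elim t)
    show ?case
    proof
      assume "t \<ge> 0"
      \<comment> \<open>The strict inequality keeps \<open>t\<close> away from the right endpoint,
        so that derivatives within \<open>{0..real n}\<close> and within \<open>{0..}\<close>
        agree.\<close>
      obtain n where n: "t < real n" using reals_Archimedean2 by blast
      have "((\<lambda>t. integral {0..t} K) has_vector_derivative K t) (at t within {0..real n})"
        using N(2)[of t n] elim n \<open>t \<ge> 0\<close> by auto
      moreover have "at t within {0..real n} = at t within {0..}"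
        by (rule at_within_nhd[of _ "{..<real n}"]) (use n in auto)
      ultimately have "((\<lambda>t. integral {0..t} K) has_vector_derivative K t) (at t within {0..})"
        by simp
      then show "(exposure K has_vector_derivative K t) (at t within {0..})"
        by (rule has_vector_derivative_transform[rotated 2])
           (use \<open>t \<ge> 0\<close> exposure_eq_integral[OF K] in auto)
    qed
  qed
qed

section \<open>Existence: the flow run at the accumulated exposure\<close>

lemma locally_lipschitz_compact_imp_lipschitz:
  assumes "locally_lipschitz F" "compact X"
  obtains L where "L-lipschitz_on X F"
proof -
  \<comment> \<open>A single time forms a compact set of times, as the compactness argument for
    time-dependent families requires.\<close>
  have "local_lipschitz {0::real} X (\<lambda>_. F)"
    using assms(1) unfolding locally_lipschitz_def by (rule local_lipschitz_subset) auto
  then show ?thesis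
    by (rule local_lipschitz_compact_implies_lipschitz[OF _ assms(2) compact_sing]) (auto intro: that)
qed

lemma locally_lipschitz_imp_continuous_on:
  assumes "locally_lipschitz F"
  shows "continuous_on UNIV F"
  using local_lipschitz_continuous_on[OF assms[unfolded locally_lipschitz_def]] by blast

lemma flow_lipschitz_on_interval:
  assumes F: "locally_lipschitz F" and \<Phi>: "is_complete_flow F \<Phi>"
  obtains B where "B-lipschitz_on {a..b} (\<lambda>s. \<Phi> s x)"
proof -
  have der: "((\<lambda>r. \<Phi> r x) has_vector_derivative F (\<Phi> s x)) (at s within {a..b})" for s
    using \<Phi> unfolding is_complete_flow_def by (blast intro: has_vector_derivative_at_within)
  then have "continuous_on {a..b} (\<lambda>s. \<Phi> s x)"
    by (meson continuous_on_eq_continuous_within has_vector_derivative_continuous)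
  then have "continuous_on {a..b} (\<lambda>s. F (\<Phi> s x))"
    using continuous_on_compose2[OF locally_lipschitz_imp_continuous_on[OF F]] by blast
  then have "bounded ((\<lambda>s. F (\<Phi> s x)) ` {a..b})"
    by (intro compact_imp_bounded compact_continuous_image) auto
  then obtain B where "B > 0" and B: "\<And>s. s \<in> {a..b} \<Longrightarrow> norm (F (\<Phi> s x)) \<le> B"
    unfolding bounded_pos by blast
  have "B-lipschitz_on {a..b} (\<lambda>s. \<Phi> s x)"
  proof (rule bounded_derivative_imp_lipschitz)
    fix s assume s: "s \<in> {a..b}"
    show "((\<lambda>r. \<Phi> r x) has_derivative (\<lambda>h. h *\<^sub>R F (\<Phi> s x))) (at s within {a..b})"
      using der by (simp add: has_vector_derivative_def)
    show "onorm (\<lambda>h. h *\<^sub>R F (\<Phi> s x)) \<le> B"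
    proof (rule onorm_bound)
      show "norm (h *\<^sub>R F (\<Phi> s x)) \<le> B * norm h" for h
        using mult_right_mono[OF B[OF s], of "norm h"] by (simp add: mult.commute)
    qed (use \<open>B > 0\<close> in simp)
  qed (use \<open>B > 0\<close> in auto)
  then show ?thesis by (rule that)
qed

lemma flow_exposure_protocol_solution:
  assumes F: "locally_lipschitz F" and \<Phi>: "is_complete_flow F \<Phi>" and K: "locally_integrable K"
  shows "protocol_solution F K x (\<lambda>t. \<Phi> (exposure K t) x)"
  unfolding protocol_solution_def
proof (intro conjI allI impI)
  fix T :: real assume "T \<ge> 0"
  then have ac: "absolutely_continuous_on {0..T} (exposure K)"
    using K by (rule absolutely_continuous_on_exposure[rotated])
  then have "compact (exposure K ` {0..T})"
    by (intro compact_continuous_image absolutely_continuous_on_imp_continuous_on) auto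
  \<comment> \<open>The exposure may take both signs and need not be monotone, so its range is
    enclosed in a symmetric interval of flow parameters.\<close>
  then obtain R where R: "exposure K ` {0..T} \<subseteq> {- R..R}"
    unfolding box_real(2)[symmetric] using bounded_subset_cbox_symmetric compact_imp_bounded
    by (metis real_scaleR_def)
  obtain B where "B-lipschitz_on {- R..R} (\<lambda>s. \<Phi> s x)"
    using flow_lipschitz_on_interval[OF F \<Phi>] .
  from absolutely_continuous_on_lipschitz_compose[OF ac this R]
  show "absolutely_continuous_on {0..T} (\<lambda>t. \<Phi> (exposure K t) x)" .
next
  have "exposure K 0 = 0" using exposure_eq_integral[OF K, of 0] by simp
  then show "\<Phi> (exposure K 0) x = x" using \<Phi> by (simp add: is_complete_flow_def)
next
  show "AE t in lebesgue. 0 \<le> t \<longrightarrow> ((\<lambda>t. \<Phi> (exposure K t) x) has_vector_derivative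
            K t *\<^sub>R F (\<Phi> (exposure K t) x)) (at t within {0..})"
    using AE_exposure_has_vector_derivative[OF K]
  proof eventually_elim
    case (elim t)
    \<comment> \<open>The outer function is differentiable at every parameter, so the chain rule
      holds at each \<open>t\<close> where the exposure is differentiable and creates no further
      exceptional points.\<close>
    have "((\<lambda>r. \<Phi> r x) has_vector_derivative F (\<Phi> (exposure K t) x)) (at (exposure K t) within exposure K ` {0..})"
      using \<Phi> unfolding is_complete_flow_def by (blast intro: has_vector_derivative_at_within)
    then show ?case
      using elim vector_diff_chain_within by (fastforce simp: o_def)
  qed
qed

section \<open>Uniqueness of Caratheodory solutions\<close>

text \<open>Absolute continuity turns the almost everywhere equation into the integral equation;
  integrability of the right-hand side is part of what the fundamental theorem delivers.\<close>

lemma protocol_solution_has_integral: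
  assumes \<theta>: "protocol_solution F K x \<theta>" and uv: "0 \<le> u" "u \<le> v"
  shows "((\<lambda>s. K s *\<^sub>R F (\<theta> s)) has_integral \<theta> v - \<theta> u) {u..v}"
proof -
  have "AE t in lebesgue. t \<ge> 0 \<longrightarrow>
        (\<theta> has_vector_derivative K t *\<^sub>R F (\<theta> t)) (at t within {0..})"
    using \<theta> by (simp add: protocol_solution_def)
  then obtain N where N: "negligible N" "\<And>t. t \<notin> N \<Longrightarrow> t \<ge> 0 \<Longrightarrow>
        (\<theta> has_vector_derivative K t *\<^sub>R F (\<theta> t)) (at t within {0..})"
    unfolding negligible_iff_null_sets eventually_ae_filter by auto
  show ?thesis
  proof (rule fundamental_theorem_of_calculus_absolutely_continuous[OF \<open>u \<le> v\<close> _ N(1)])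
    have "absolutely_continuous_on {0..v} \<theta>" using \<theta> uv by (simp add: protocol_solution_def)
    then show "absolutely_continuous_on {u..v} \<theta>"
      by (rule absolutely_continuous_on_subset) (use uv in auto)
    fix t assume "t \<in> {u..v} - N"
    then show "(\<theta> has_vector_derivative K t *\<^sub>R F (\<theta> t)) (at t within {u..v})"
      using uv by (intro has_vector_derivative_within_subset[OF N(2)]) auto
  qed
qed

lemma protocol_solution_unique:
  assumes F: "locally_lipschitz F" and K: "locally_integrable K"
    and \<theta>: "protocol_solution F K x \<theta>" and \<psi>: "protocol_solution F K x \<psi>" and "T \<ge> 0"
  shows "\<theta> T = \<psi> T"
proof -
  have cont: "continuous_on {0..T} \<theta>" "continuous_on {0..T} \<psi>"
    using \<theta> \<psi> \<open>T \<ge> 0\<close>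
    by (auto simp: protocol_solution_def intro: absolutely_continuous_on_imp_continuous_on)
  then have "compact (\<theta> ` {0..T} \<union> \<psi> ` {0..T})"
    by (intro compact_Un compact_continuous_image) auto
  then obtain L where L: "L-lipschitz_on (\<theta> ` {0..T} \<union> \<psi> ` {0..T}) F"
    by (rule locally_lipschitz_compact_imp_lipschitz[OF F])
  have "L \<ge> 0" using L by (rule lipschitz_on_nonneg)
  have absK: "(\<lambda>s. \<bar>K s\<bar>) integrable_on {0..T}" "(\<lambda>s. \<bar>K s\<bar>) absolutely_integrable_on {0..T}"
    using K \<open>T \<ge> 0\<close> by (auto simp: locally_integrable_def absolutely_integrable_on_def)
  \<comment> \<open>With this bound on the integral of \<open>\<bar>K\<bar>\<close>, multiplication
    by \<open>L\<close> gives at most 1/2, also when \<open>L\<close> is zero.\<close>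
  have "1 / (2 * (L + 1)) > 0" using \<open>L \<ge> 0\<close> by simp
  then obtain d where "d > 0" and d: "\<And>u v. \<lbrakk>u \<le> v; {u..v} \<subseteq> {0..T}; v - u < d\<rbrakk> \<Longrightarrow>
      norm (integral {0..v} (\<lambda>s. \<bar>K s\<bar>) - integral {0..u} (\<lambda>s. \<bar>K s\<bar>)) < 1 / (2 * (L + 1))"
    using absolutely_continuous_on_small_interval[OF absolutely_continuous_on_integral[OF absK(2)]] by blast
  have step: "\<theta> t = \<psi> t"
    if uv: "0 \<le> u" "v \<le> T" "v - u < d" and eq: "\<theta> u = \<psi> u" and t: "t \<in> {u..v}" for u v t
  proof -
    have "continuous_on {u..v} (\<lambda>s. norm (\<theta> s - \<psi> s))"
      using uv by (intro continuous_intros continuous_on_subset[OF cont(1)] continuous_on_subset[OF cont(2)]) auto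
    \<comment> \<open>Integrating only up to a point \<open>m\<close> of maximal distance
      \<open>M\<close> gives \<open>M \<le> M / 2\<close>: before \<open>m\<close> the integrand is
      at most \<open>L * M * \<bar>K s\<bar>\<close>, and the solutions agree at
      \<open>u\<close>.\<close>
    then obtain m where m: "m \<in> {u..v}" and
      max: "\<And>s. s \<in> {u..v} \<Longrightarrow> norm (\<theta> s - \<psi> s) \<le> norm (\<theta> m - \<psi> m)"
      using continuous_attains_sup[of "{u..v}" "\<lambda>s. norm (\<theta> s - \<psi> s)"] t by auto
    define M where "M = norm (\<theta> m - \<psi> m)"
    have um: "{u..m} \<subseteq> {0..T}" "u \<le> m" "m - u < d" using m uv by auto
    have "((\<lambda>s. K s *\<^sub>R F (\<theta> s) - K s *\<^sub>R F (\<psi> s)) has_integral (\<theta> m - \<theta> u) - (\<psi> m - \<psi> u)) {u..m}"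
      using \<theta> \<psi> uv um by (intro has_integral_diff protocol_solution_has_integral)
    then have hi: "((\<lambda>s. K s *\<^sub>R F (\<theta> s) - K s *\<^sub>R F (\<psi> s)) has_integral \<theta> m - \<psi> m) {u..m}"
      by (simp add: eq)
    have Ki: "(\<lambda>s. \<bar>K s\<bar>) integrable_on {u..m}"
      by (rule integrable_on_subinterval[OF absK(1) um(1)])
    have "M = norm (integral {u..m} (\<lambda>s. K s *\<^sub>R F (\<theta> s) - K s *\<^sub>R F (\<psi> s)))"
      using hi by (simp add: M_def integral_unique)
    also have "\<dots> \<le> integral {u..m} (\<lambda>s. L * M * \<bar>K s\<bar>)"
    proof (rule integral_norm_bound_integral)
      show "(\<lambda>s. K s *\<^sub>R F (\<theta> s) - K s *\<^sub>R F (\<psi> s)) integrable_on {u..m}"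
        using hi by blast
      show "(\<lambda>s. L * M * \<bar>K s\<bar>) integrable_on {u..m}"
        using integrable_on_cmult_left[OF Ki, of "L * M"] by simp
      fix s assume s: "s \<in> {u..m}"
      have "norm (F (\<theta> s) - F (\<psi> s)) \<le> L * norm (\<theta> s - \<psi> s)"
        using s um by (intro lipschitz_on_normD[OF L]) auto
      also have "\<dots> \<le> L * M"
        using max[of s] s m \<open>L \<ge> 0\<close> by (auto simp: M_def intro: mult_left_mono)
      finally have "\<bar>K s\<bar> * norm (F (\<theta> s) - F (\<psi> s)) \<le> \<bar>K s\<bar> * (L * M)"
        by (rule mult_left_mono) simp
      then show "norm (K s *\<^sub>R F (\<theta> s) - K s *\<^sub>R F (\<psi> s)) \<le> L * M * \<bar>K s\<bar>"
        by (simp add: mult.commute flip: scaleR_diff_right)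
    qed
    also have "\<dots> = L * M * integral {u..m} (\<lambda>s. \<bar>K s\<bar>)"
      by simp
    also have "\<dots> \<le> L * M * (1 / (2 * (L + 1)))"
    proof (rule mult_left_mono)
      have "integral {0..u} (\<lambda>s. \<bar>K s\<bar>) + integral {u..m} (\<lambda>s. \<bar>K s\<bar>) = integral {0..m} (\<lambda>s. \<bar>K s\<bar>)"
        using uv um by (intro Henstock_Kurzweil_Integration.integral_combine integrable_on_subinterval[OF absK(1)]) auto
      then show "integral {u..m} (\<lambda>s. \<bar>K s\<bar>) \<le> 1 / (2 * (L + 1))"
        using d[OF um(2,1,3)] by simp
      show "0 \<le> L * M" using \<open>L \<ge> 0\<close> by (simp add: M_def)
    qed
    also have "\<dots> = (L / (L + 1)) * (M / 2)"
      using \<open>L \<ge> 0\<close> by (simp add: field_simps)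
    also have "\<dots> \<le> 1 * (M / 2)"
      using \<open>L \<ge> 0\<close> by (intro mult_right_mono) (auto simp: M_def)
    finally have "M \<le> 0" by simp
    then have "norm (\<theta> t - \<psi> t) \<le> 0" using max[OF t] by (simp add: M_def)
    then show ?thesis by simp
  qed
  \<comment> \<open>Agreement is carried forward in steps of \<open>d / 2\<close>, because an
    interval of length exactly \<open>d\<close> would violate the strict condition in
    \<open>step\<close>.\<close>
  have all: "\<forall>t\<in>{0..min T (real n * (d / 2))}. \<theta> t = \<psi> t" for n
  proof (induction n)
    case 0
    then show ?case using \<theta> \<psi> \<open>T \<ge> 0\<close> by (simp add: protocol_solution_def)
  next
    case (Suc n)
    show ?case
    proof
      fix t assume t: "t \<in> {0..min T (real (Suc n) * (d / 2))}"
      let ?u = "real n * (d / 2)"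
      show "\<theta> t = \<psi> t"
      proof (cases "t \<le> ?u")
        case True
        then show ?thesis using Suc t by auto
      next
        case False
        moreover have "t - ?u < d"
          using t \<open>d > 0\<close> by (simp add: algebra_simps)
        moreover have "?u \<ge> 0" using \<open>d > 0\<close> by simp
        moreover have "\<theta> ?u = \<psi> ?u" using Suc False t \<open>?u \<ge> 0\<close> by auto
        ultimately show ?thesis using t by (intro step[of ?u t t]) auto
      qed
    qed
  qed
  obtain n where "T / (d / 2) < real n" using reals_Archimedean2 by blast
  then have "T < real n * (d / 2)" using \<open>d > 0\<close> by (simp add: field_simps)
  then show ?thesis using all[of n] \<open>T \<ge> 0\<close> by (simp add: min_def)
qed

section \<open>Change of representative on the torus\<close>

text \<open>Periodicity gives one turn in one coordinate. Induction over the integers in both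
  directions yields any number of turns, and induction over finite sets of coordinates then yields
  every lattice vector.\<close>

lemma torus_vector_field_cong:
  fixes F :: "real ^ 'n \<Rightarrow> real ^ 'n"
  assumes F: "torus_vector_field F" and "torus_eq y x"
  shows "F y = F x"
proof -
  have per: "F (z + axis i (2 * pi * of_int k)) = F z" for z i and k :: int
  proof (induction k arbitrary: z rule: int_induct[where k = 0])
    case base
    then show ?case by (simp add: axis_def flip: zero_vec_def)
  next
    case (step1 k)
    have "z + axis i (2 * pi * of_int (k + 1)) = (z + axis i (2 * pi * of_int k)) + axis i (2 * pi)"
      by (simp add: vec_eq_iff axis_def algebra_simps)
    then show ?case using step1 F unfolding torus_vector_field_def by metis
  next
    case (step2 k)
    \<comment> \<open>Periodicity only adds a turn, so for the downward step it is applied at the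
      point that is already one turn back.\<close>
    have "F (z + axis i (2 * pi * of_int (k - 1))) = F ((z + axis i (2 * pi * of_int (k - 1))) + axis i (2 * pi))"
      using F by (simp add: torus_vector_field_def)
    also have "(z + axis i (2 * pi * of_int (k - 1))) + axis i (2 * pi) = z + axis i (2 * pi * of_int k)"
      by (simp add: vec_eq_iff axis_def algebra_simps)
    finally show ?case using step2 by simp
  qed
  obtain k where k: "\<And>i. y $ i - x $ i = 2 * pi * of_int (k i :: int)"
    using assms(2) unfolding torus_eq_def by metis
  have "F (x + (\<Sum>i\<in>A. axis i (2 * pi * of_int (k i)))) = F x" if "finite A" for A
    using that
  proof (induction A rule: finite_induct)
    case (insert i A)
    then show ?case
      using per[of "x + (\<Sum>i\<in>A. axis i (2 * pi * of_int (k i)))" i "k i"] by (simp add: ac_simps)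
  qed simp
  moreover have "x + (\<Sum>i\<in>UNIV. axis i (2 * pi * of_int (k i))) = y"
    by (simp add: vec_eq_iff axis_def flip: k)
  ultimately show ?thesis by (metis finite)
qed

lemma torus_eq_add_diff: "torus_eq y x \<Longrightarrow> torus_eq z (z + (x - y))"
  unfolding torus_eq_def by (simp add: algebra_simps)

lemma protocol_solution_translate:
  assumes F: "torus_vector_field F" and "torus_eq y x" and \<theta>: "protocol_solution F K y \<theta>"
  shows "protocol_solution F K x (\<lambda>t. \<theta> t + (x - y))"
proof -
  have "F (\<theta> t + (x - y)) = F (\<theta> t)" for t
    using torus_vector_field_cong[OF F torus_eq_add_diff[OF assms(2)]] by metis
  then show ?thesis
    using \<theta> by (auto simp: protocol_solution_def absolutely_continuous_on_add_const
        has_vector_derivative_def has_derivative_add_const)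
qed

theorem theorem1:
  fixes F :: "real ^ 'n \<Rightarrow> real ^ 'n"
    and \<Phi> :: "real \<Rightarrow> real ^ 'n \<Rightarrow> real ^ 'n"
  assumes "torus_vector_field F"
    and "locally_lipschitz F"
    and "is_complete_flow F \<Phi>"
  shows "(\<forall>K x. locally_integrable K \<longrightarrow>
            protocol_solution F K x (\<lambda>t. \<Phi> (exposure K t) x) \<and>
            (\<forall>\<theta>. protocol_solution F K x \<theta> \<longrightarrow>
                  (\<forall>t\<ge>0. \<theta> t = \<Phi> (exposure K t) x)) \<and>
            (\<forall>y \<theta>. torus_eq y x \<and> protocol_solution F K y \<theta> \<longrightarrow>
                  (\<forall>t\<ge>0. torus_eq (\<theta> t) (\<Phi> (exposure K t) x)))) \<and>
         (\<forall>K\<^sub>a K\<^sub>b x y \<theta>\<^sub>a \<theta>\<^sub>b t\<^sub>a t\<^sub>b.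
            locally_integrable K\<^sub>a \<and> locally_integrable K\<^sub>b \<and>
            protocol_solution F K\<^sub>a x \<theta>\<^sub>a \<and> protocol_solution F K\<^sub>b y \<theta>\<^sub>b \<and>
            t\<^sub>a \<ge> 0 \<and> t\<^sub>b \<ge> 0 \<and> exposure K\<^sub>a t\<^sub>a = exposure K\<^sub>b t\<^sub>b \<longrightarrow>
            (x = y \<longrightarrow> \<theta>\<^sub>a t\<^sub>a = \<theta>\<^sub>b t\<^sub>b) \<and>
            (torus_eq x y \<longrightarrow> torus_eq (\<theta>\<^sub>a t\<^sub>a) (\<theta>\<^sub>b t\<^sub>b)))"
proof -
  note ex = flow_exposure_protocol_solution[OF assms(2,3)]
  have unique: "\<theta> t = \<Phi> (exposure K t) x"
    if "locally_integrable K" "protocol_solution F K x \<theta>" "t \<ge> 0" for K x \<theta> t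
    using protocol_solution_unique[OF assms(2) that(1,2) ex[OF that(1)] that(3)] .
  \<comment> \<open>The translate of \<open>\<theta>\<close> by the lattice vector
    \<open>x - y\<close> starts at \<open>x\<close>, so uniqueness identifies it with the flow from
    \<open>x\<close>; undoing the translation costs only a lattice vector.\<close>
  have torus: "torus_eq (\<theta> t) (\<Phi> (exposure K t) x)"
    if "locally_integrable K" "torus_eq y x" "protocol_solution F K y \<theta>" "t \<ge> 0" for K x y \<theta> t
    using unique[OF that(1) protocol_solution_translate[OF assms(1) that(2,3)] that(4)]
      torus_eq_add_diff[OF that(2), of "\<theta> t"] by simp
  show ?thesis
  proof (intro conjI allI impI; (elim conjE)?)
    fix K\<^sub>a K\<^sub>b x y \<theta>\<^sub>a \<theta>\<^sub>b t\<^sub>a t\<^sub>b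
    assume K: "locally_integrable K\<^sub>a" "locally_integrable K\<^sub>b"
      and \<theta>: "protocol_solution F K\<^sub>a x \<theta>\<^sub>a" "protocol_solution F K\<^sub>b y \<theta>\<^sub>b"
      and t: "t\<^sub>a \<ge> 0" "t\<^sub>b \<ge> 0" and S: "exposure K\<^sub>a t\<^sub>a = exposure K\<^sub>b t\<^sub>b"
    show "\<theta>\<^sub>a t\<^sub>a = \<theta>\<^sub>b t\<^sub>b" if "x = y"
      using unique[OF K(1) \<theta>(1) t(1)] unique[OF K(2) \<theta>(2) t(2)] S that by simp
    \<comment> \<open>Both states are compared with the flow from \<open>y\<close>: the second
      equals it exactly, the first up to a lattice vector.\<close>
    show "torus_eq (\<theta>\<^sub>a t\<^sub>a) (\<theta>\<^sub>b t\<^sub>b)" if "torus_eq x y"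
      using torus[OF K(1) that \<theta>(1) t(1)] unique[OF K(2) \<theta>(2) t(2)] S by simp
  qed (blast intro: ex unique torus)+
qed

end
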